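(* For each integer $r\ge 3$ let $f_{r,2}(x)=1+x+x^{2^r}+x^{2^r+2}\in\mathbb{F}_2[x]$. Then for every $r\geq 3$ the polynomial $f_{r,2}$ is robust and its order divides $4^r+2^r+1$; moreover $\displaystyle\lim_{r\to\infty}\gamma(f_{r,2})=1$.
   Context: For $f\in\mathbb{F}_2[x]$ with $f(0)=1$ and $\deg f\ge 1$, the order $\operatorname{ord}(f)$ is the least integer $D\ge 1$ such that $f(x)\mid 1+x^D$ in $\mathbb{F}_2[x]$. With $D=\operatorname{ord}(f)$, let $f^*(x)\in\mathbb{F}_2[x]$ be defined by $f(x)f^*(x)=1+x^D$. For $g\in\mathbb{F}_2[x]$, $\ell_1(g)$ is the number of monomials of $g$ (terms with coefficient $1$), and for $N\ge\deg g$, $\ell_{0,N}(g)$ is the number of exponents $k\in\{0,1,\dots,N\}$ for which the coefficient of $x^k$ in $g$ is $0$. Define $\gamma(f)=\ell_1(f^* )/D$. The polynomial $f$ is called robust if $\ell_1(f^* )>\ell_{0,D-1}(f^* )+1$, equivalently $\ell_1(f^* )>(D+1)/2$. *)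

theory Defs
  imports Complex_Main "HOL-Computational_Algebra.Computational_Algebra" "HOL-Library.Z2"
begin

text \<open>The field with two elements is the type \<^typ>\<open>bit\<close>.\<close>

definition poly_ord :: "bit poly \<Rightarrow> nat" where
  "poly_ord f = (LEAST D. D \<ge> 1 \<and> f dvd 1 + monom 1 D)"

definition poly_star :: "bit poly \<Rightarrow> bit poly" where
  "poly_star f = (THE g. f * g = 1 + monom 1 (poly_ord f))"

definition ell1 :: "bit poly \<Rightarrow> nat" where
  "ell1 g = card {k. coeff g k = 1}"

text \<open>Meant for \<^term>\<open>N \<ge> degree g\<close>.\<close>

definition ell0 :: "nat \<Rightarrow> bit poly \<Rightarrow> nat" where
  "ell0 N g = card {k \<in> {0..N}. coeff g k = 0}"

definition gamma :: "bit poly \<Rightarrow> real" where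
  "gamma f = real (ell1 (poly_star f)) / real (poly_ord f)"

definition robust :: "bit poly \<Rightarrow> bool" where
  "robust f \<longleftrightarrow> ell1 (poly_star f) > ell0 (poly_ord f - 1) (poly_star f) + 1"

definition f_r2 :: "nat \<Rightarrow> bit poly" where
  "f_r2 r = 1 + monom 1 1 + monom 1 (2 ^ r) + monom 1 (2 ^ r + 2)"

text \<open>The order and the cofactor are well defined as soon as the constant coefficient is 1:
  two powers of the variable agree modulo \<open>f\<close>, and the variable is a unit modulo \<open>f\<close>.\<close>

lemma finite_bit_poly_degree_le: "finite {p :: bit poly. degree p \<le> n}"
proof -
  have "inj_on (\<lambda>p :: bit poly. {k. coeff p k = 1}) {p. degree p \<le> n}"
  proof (rule inj_onI)
    fix p q :: "bit poly"
    assume "{k. coeff p k = 1} = {k. coeff q k = 1}"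
    then have "coeff p k = 1 \<longleftrightarrow> coeff q k = 1" for k by blast
    then have "coeff p k = coeff q k" for k by (metis bit_not_one_iff)
    then show "p = q" by (simp add: poly_eqI)
  qed
  moreover have "(\<lambda>p :: bit poly. {k. coeff p k = 1}) ` {p. degree p \<le> n} \<subseteq> Pow {..n}"
    by (auto intro: le_degree dest: le_degree order_trans)
       (metis le_degree le_trans one_neq_zero)
  ultimately show ?thesis
    by (meson finite_Pow_iff finite_atMost inj_on_finite)
qed

lemma poly_ord_exists:
  fixes f :: "bit poly"
  assumes "coeff f 0 = 1"
  shows "\<exists>D\<ge>1. f dvd 1 + monom 1 D"
proof -
  have f0: "f \<noteq> 0" using assms by auto
  have "range (\<lambda>i. monom 1 i mod f) \<subseteq> {p. degree p \<le> degree f}"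
    using f0 by (auto intro: degree_mod_less_degree less_imp_le)
      (metis degree_0 degree_mod_less' f0 le0 less_imp_le)
  then have "finite (range (\<lambda>i. monom (1::bit) i mod f))"
    using finite_bit_poly_degree_le finite_subset by blast
  then have "\<not> inj (\<lambda>i. monom (1::bit) i mod f)"
    using finite_imageD infinite_UNIV_nat by blast
  then obtain i j where ij: "i < j" "monom (1::bit) i mod f = monom 1 j mod f"
    unfolding inj_def by (metis nat_neq_iff)
  then have "f dvd monom 1 j - monom 1 i" by (metis mod_eq_dvd_iff)
  also have "monom 1 j - monom 1 i = monom (1::bit) i * (1 + monom 1 (j - i))"
  proof -
    have "monom (1::bit) j = monom 1 i * monom 1 (j - i)"
      using ij(1) by (simp add: mult_monom)
    moreover have "- monom (1::bit) i = monom 1 i" by (simp add: minus_monom)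
    ultimately show ?thesis by (simp only: diff_conv_add_uminus) (simp add: algebra_simps)
  qed
  finally have d: "f dvd monom 1 i * (1 + monom 1 (j - i))" .
  have "f = pCons 1 (poly_shift 1 f)"
    by (rule poly_eqI) (use assms in \<open>simp add: coeff_pCons coeff_poly_shift split: nat.split\<close>)
  then have f: "f = 1 + [:0, 1:] * poly_shift 1 f" by (simp add: one_pCons)
  have X: "f dvd h" if "f dvd [:0, 1:] * h" for h
  proof -
    have "h = f * h - poly_shift 1 f * ([:0, 1:] * h)"
      by (subst f) (simp only: algebra_simps, simp)
    then show ?thesis using that by (metis dvd_diff dvd_mult dvd_triv_left)
  qed
  have "f dvd h" if "f dvd [:0, 1:] ^ n * h" for n h
    using that by (induction n) (auto simp only: power_0 power_Suc mult_1 mult.assoc dest: X)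
  then have "f dvd 1 + monom 1 (j - i)" using d by (simp only: monom_altdef smult_1_left)
  then show ?thesis using ij(1) by (intro exI[of _ "j - i"]) auto
qed

lemma poly_ord_props:
  assumes "coeff f 0 = 1"
  shows "poly_ord f \<ge> 1" "f dvd 1 + monom 1 (poly_ord f)"
  using LeastI_ex[of "\<lambda>D. D \<ge> 1 \<and> f dvd 1 + monom 1 D"] poly_ord_exists[OF assms]
  unfolding poly_ord_def by blast+

lemma poly_star_eq:
  assumes "coeff f 0 = 1"
  shows "f * poly_star f = 1 + monom 1 (poly_ord f)"
proof -
  have f0: "f \<noteq> 0" using assms by auto
  obtain g where g: "f * g = 1 + monom 1 (poly_ord f)"
    using poly_ord_props(2)[OF assms] by (metis dvdE)
  show ?thesis unfolding poly_star_def
    by (rule theI[of _ g]) (use g f0 in \<open>metis mult_left_cancel\<close>)+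
qed

end

theory Submission
  imports Defs
begin

text \<open>Write \<open>q = 2\<^sup>r\<close>, \<open>y = 1 + x\<close>, \<open>a = x\<^sup>q y\<close>. Then \<open>f_r2 r = y (1 + a)\<close>, and by the Frobenius identity
  \<open>a\<^sup>q = x^(q\<^sup>2) (1 + x\<^sup>q)\<close> the geometric sum \<open>1 + a + \<dots> + a^(q-1)\<close> leads to
  \<open>(1 + x^(q\<^sup>2+q+1)) / f_r2 r = (1 + x + \<dots> + x^(q\<^sup>2-1)) + (x\<^sup>q + x^(2q) y + \<dots> + x^((q-1)q) y^(q-2))\<close>.
  The summands of the second bracket lie in disjoint blocks of length \<open>q\<close> and are rows of Pascal's
  triangle modulo 2; they have \<open>3\<^sup>r - 2\<^sup>r\<close> ones altogether. So the quotient has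
  \<open>4\<^sup>r - 3\<^sup>r + 2\<^sup>r\<close> ones. It consists of copies of the cofactor of period \<open>D = poly_ord (f_r2 r)\<close>, whence
  \<open>gamma\<close> is this number divided by \<open>4\<^sup>r + 2\<^sup>r + 1\<close>. As \<open>D \<ge> q + 2 \<ge> 10\<close>, robustness follows.\<close>

section \<open>Arithmetic in characteristic 2\<close>

lemma bit_poly_add_self: "p + p = (0 :: bit poly)"
proof -
  have "b + b = 0" for b :: bit by (cases b) simp_all
  then show ?thesis by (intro poly_eqI) (simp only: coeff_add coeff_0)
qed

lemma bit_poly_diff_eq_add: "p - q = p + (q :: bit poly)"
  by (simp add: diff_eq_eq add.assoc bit_poly_add_self)

lemma bit_poly_one_add_power_two_power: "(1 + p) ^ 2 ^ n = 1 + (p :: bit poly) ^ 2 ^ n"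
proof (induction n)
  case (Suc n)
  have "(1 + s) ^ 2 = 1 + s ^ 2 + (s + s)" for s :: "bit poly"
    by (simp add: power2_eq_square algebra_simps)
  then show ?case
    using Suc by (simp add: power_mult bit_poly_add_self mult.commute[of 2])
qed simp

lemma bit_poly_geometric_sum: "(1 + p) * (\<Sum>i<n. p ^ i) = 1 + (p :: bit poly) ^ n"
  by (metis one_diff_power_eq bit_poly_diff_eq_add)

lemma monom_one_eq_power: "monom (1::'a::comm_semiring_1) n = [:0, 1:] ^ n"
  by (simp add: monom_altdef)

section \<open>Supports and their cardinalities\<close>

definition ones :: "bit poly \<Rightarrow> nat set" where
  "ones p = {k. coeff p k = 1}"

lemma ell1_eq_card_ones: "ell1 p = card (ones p)"
  by (simp add: ell1_def ones_def)

lemma finite_ones [simp]: "finite (ones p)"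
  by (rule finite_subset[of _ "{..degree p}"]) (auto simp: ones_def intro: le_degree)

lemma ones_subset_degree:
  assumes "degree p < n"
  shows "ones p \<subseteq> {..<n}"
  using assms le_degree[of p] unfolding ones_def by fastforce

lemma ones_add: "ones (p + q) = (ones p - ones q) \<union> (ones q - ones p)"
proof -
  have "b + c = 1 \<longleftrightarrow> (b = 1 \<and> c \<noteq> 1) \<or> (c = 1 \<and> b \<noteq> 1)" for b c :: bit
    by (cases b; cases c) auto
  then show ?thesis by (auto simp: ones_def)
qed

lemma ones_power_mult: "ones ([:0, 1:] ^ n * p) = (+) n ` ones p"
  by (force simp: ones_def coeff_monom_mult image_iff nat_le_iff_add
      simp flip: monom_one_eq_power split: if_splits)

lemma ell1_power_mult: "ell1 ([:0, 1:] ^ n * p) = ell1 p"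
  by (simp add: ell1_eq_card_ones ones_power_mult card_image)

lemma ell1_append:
  assumes "ones p \<subseteq> {..<n}"
  shows "ell1 (p + [:0, 1:] ^ n * q) = ell1 p + ell1 q"
proof -
  have disj: "ones p \<inter> ones ([:0, 1:] ^ n * q) = {}"
    using assms by (auto simp: ones_power_mult)
  then have "ones (p + [:0, 1:] ^ n * q) = ones p \<union> ones ([:0, 1:] ^ n * q)"
    unfolding ones_add by blast
  then show ?thesis
    using disj ell1_power_mult[of n q] by (simp add: ell1_eq_card_ones card_Un_disjoint)
qed

text \<open>The support bound is carried through the induction together with the count: it keeps the
  next block, shifted by \<open>m * n\<close>, disjoint from the earlier ones.\<close>

lemma ell1_sum_blocks:
  assumes "\<And>k. k < n \<Longrightarrow> ones (p k) \<subseteq> {..<m}"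
  shows "ones (\<Sum>k<n. [:0, 1:] ^ (m * k) * p k) \<subseteq> {..<m * n} \<and>
    ell1 (\<Sum>k<n. [:0, 1:] ^ (m * k) * p k) = (\<Sum>k<n. ell1 (p k))"
  using assms
proof (induction n)
  case 0
  then show ?case by (simp add: ones_def ell1_def)
next
  case (Suc n)
  let ?S = "\<Sum>k<n. [:0, 1:] ^ (m * k) * p k"
  have IH: "ones ?S \<subseteq> {..<m * n}" "ell1 ?S = (\<Sum>k<n. ell1 (p k))"
    using Suc by auto
  have "ones (p n) \<subseteq> {..<m}" using Suc.prems by simp
  then have "ones ([:0, 1:] ^ (m * n) * p n) \<subseteq> {..<m * Suc n}"
    by (auto simp: ones_power_mult)
  moreover have "ones ?S \<subseteq> {..<m * Suc n}" using IH(1) by fastforce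
  ultimately have "ones (?S + [:0, 1:] ^ (m * n) * p n) \<subseteq> {..<m * Suc n}"
    unfolding ones_add by blast
  then show ?case using IH by (simp add: ell1_append)
qed

lemma ones_geometric_sum: "ones (\<Sum>i<n. [:0, 1:] ^ i) = {..<n}"
  by (auto simp: ones_def coeff_sum simp flip: monom_one_eq_power)

text \<open>Adding the all-ones polynomial complements the support within
  \<open>{..<n}\<close>.\<close>

lemma ell1_geometric_sum_add:
  assumes "ones p \<subseteq> {..<n}"
  shows "ell1 ((\<Sum>i<n. [:0, 1:] ^ i) + p) + ell1 p = n"
proof -
  have "ones ((\<Sum>i<n. [:0, 1:] ^ i) + p) = {..<n} - ones p"
    using assms by (auto simp: ones_add ones_geometric_sum)
  then show ?thesis
    using assms card_mono[OF _ assms] by (simp add: ell1_eq_card_ones card_Diff_subset)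
qed

section \<open>Rows of Pascal's triangle modulo 2\<close>

lemma ones_one_add_X_power: "k < n \<Longrightarrow> ones ((1 + [:0, 1:]) ^ k) \<subseteq> {..<n}"
  by (rule ones_subset_degree) (simp add: one_pCons degree_linear_power)

text \<open>By Frobenius, with \<open>X = [:0, 1:]\<close>,
  \<open>(1 + X) ^ 2 ^ r = 1 + X ^ 2 ^ r\<close>. So row \<open>2 ^ r + k\<close> is two copies of
  row \<open>k\<close>, disjoint because row \<open>k\<close> has degree
  \<open>k < 2 ^ r\<close>.\<close>

lemma ell1_one_add_X_power_add:
  assumes "k < 2 ^ r"
  shows "ell1 ((1 + [:0, 1:]) ^ (2 ^ r + k)) = 2 * ell1 ((1 + [:0, 1:]) ^ k)"
proof -
  have "(1 + [:0, 1:]) ^ (2 ^ r + k) =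
      (1 + [:0, 1:]) ^ k + [:0, 1:] ^ 2 ^ r * (1 + [:0, 1:] :: bit poly) ^ k"
    by (simp only: power_add bit_poly_one_add_power_two_power distrib_right mult_1_left)
  then show ?thesis
    by (simp only: ell1_append[OF ones_one_add_X_power[OF assms]])
qed

lemma sum_lessThan_add:
  fixes f :: "nat \<Rightarrow> 'a::comm_monoid_add"
  shows "(\<Sum>k<m + n. f k) = (\<Sum>k<m. f k) + (\<Sum>k<n. f (m + k))"
  by (induction n) (simp_all add: add.assoc)

text \<open>Sierpinski self-similarity: the next \<open>2 ^ r\<close> rows repeat the first
  \<open>2 ^ r\<close> rows with doubled counts, so doubling the number of rows triples the
  total.\<close>

lemma sum_ell1_one_add_X_power: "(\<Sum>k<2 ^ r. ell1 ((1 + [:0, 1:]) ^ k)) = 3 ^ r"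
proof (induction r)
  case 0
  show ?case by (simp add: ell1_def)
next
  case (Suc r)
  let ?w = "\<lambda>k. ell1 ((1 + [:0, 1:]) ^ k)"
  have "(\<Sum>k<2 ^ Suc r. ?w k) = (\<Sum>k<2 ^ r. ?w k) + (\<Sum>k<2 ^ r. ?w (2 ^ r + k))"
    by (simp only: power_Suc mult_2 sum_lessThan_add)
  also have "(\<Sum>k<2 ^ r. ?w (2 ^ r + k)) = (\<Sum>k<2 ^ r. 2 * ?w k)"
    by (intro sum.cong refl ell1_one_add_X_power_add) simp
  finally show ?case using Suc by (simp add: sum_distrib_left[symmetric])
qed

text \<open>Counts the last of the first \<open>2 ^ r\<close> rows, the one that the sum in
  \<open>cofactor_r2\<close> leaves out.\<close>

lemma ell1_one_add_X_power_two_power_minus_one: "ell1 ((1 + [:0, 1:]) ^ (2 ^ r - 1)) = 2 ^ r"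
proof (induction r)
  case 0
  show ?case by (simp add: ell1_def)
next
  case (Suc r)
  have eq: "2 ^ Suc r - 1 = 2 ^ r + (2 ^ r - 1 :: nat)" by simp
  show ?case unfolding eq by (subst ell1_one_add_X_power_add) (use Suc in simp_all)
qed

section \<open>The explicit quotient\<close>

text \<open>The cofactor for the exponent \<open>4 ^ r + 2 ^ r + 1\<close>. This exponent may be a
  proper multiple of the order, so no equality with \<open>poly_star (f_r2 r)\<close> is
  claimed.\<close>

definition cofactor_r2 :: "nat \<Rightarrow> bit poly" where
  "cofactor_r2 r = (\<Sum>i<4 ^ r. [:0, 1:] ^ i) +
     [:0, 1:] ^ 2 ^ r * (\<Sum>k<2 ^ r - 1. [:0, 1:] ^ (2 ^ r * k) * (1 + [:0, 1:]) ^ k)"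

lemma four_power_eq: "(4::nat) ^ r = 2 ^ r * 2 ^ r"
  by (simp flip: power_mult_distrib)

lemma f_r2_mult_cofactor_r2: "f_r2 r * cofactor_r2 r = 1 + monom 1 (4 ^ r + 2 ^ r + 1)"
proof -
  define X :: "bit poly" where "X = [:0, 1:]"
  define q :: nat where "q = 2 ^ r"
  define a where "a = X ^ q * (1 + X)"
  have q: "q = Suc (q - 1)" by (simp add: q_def)
  have f: "f_r2 r = (1 + X) * (1 + a)"
  proof -
    have "(1 + X) * (1 + a) = 1 + X + X ^ q + X ^ (q + 2) + (X ^ (q + 1) + X ^ (q + 1))"
      by (simp add: a_def algebra_simps power_add power2_eq_square)
    then show ?thesis
      by (simp add: f_r2_def monom_one_eq_power bit_poly_add_self del: power_Suc flip: X_def q_def)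
  qed
  have aq: "a ^ q = X ^ (q * q) * (1 + X ^ q)"
    by (simp add: a_def power_mult_distrib bit_poly_one_add_power_two_power q_def flip: power_mult)
  \<comment> \<open>Splitting off the term \<open>k = 0\<close> leaves \<open>a\<close> times the
    shorter sum; in \<open>geo\<close> this \<open>a\<close> arises from the factors
    \<open>1 + X\<close> and \<open>X ^ q\<close>.\<close>
  have "a * (\<Sum>k<q - 1. a ^ k) + 1 = (\<Sum>k<q. a ^ k)"
    by (subst (2) q) (simp add: sum.lessThan_Suc_shift sum_distrib_left add.commute del: sum.lessThan_Suc)
  moreover have "a ^ k = X ^ (q * k) * (1 + X) ^ k" for k
    by (simp add: a_def power_mult_distrib power_mult)
  ultimately have geo: "(1 + X) * (X ^ q * (\<Sum>k<q - 1. X ^ (q * k) * (1 + X) ^ k)) = (\<Sum>k<q. a ^ k) + 1"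
    by (metis (no_types, lifting) a_def add.assoc add.right_neutral bit_poly_add_self mult.assoc mult.commute sum.cong)
  have "(1 + X) * cofactor_r2 r = (1 + X) * (\<Sum>i<q * q. X ^ i) +
      (1 + X) * (X ^ q * (\<Sum>k<q - 1. X ^ (q * k) * (1 + X) ^ k))"
    by (simp only: cofactor_r2_def four_power_eq distrib_left flip: X_def q_def)
  also have "\<dots> = X ^ (q * q) + (\<Sum>k<q. a ^ k) + (1 + 1)"
    by (simp only: geo bit_poly_geometric_sum) (simp only: ac_simps)
  also have "\<dots> = X ^ (q * q) + (\<Sum>k<q. a ^ k)" by (simp only: bit_poly_add_self add_0_right)
  finally have "f_r2 r * cofactor_r2 r = (1 + a) * X ^ (q * q) + (1 + a) * (\<Sum>k<q. a ^ k)"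
    by (metis f mult.commute mult.assoc distrib_left)
  \<comment> \<open>The second product telescopes to
    \<open>1 + a ^ q = 1 + X ^ (q * q) + X ^ (q * q + q)\<close>; both nonconstant terms cancel
    against the expansion of the first product.\<close>
  also have "\<dots> = 1 + X ^ (q * q + q + 1) + (X ^ (q * q) + X ^ (q * q))
      + (X ^ (q * q + q) + X ^ (q * q + q))"
    by (simp only: bit_poly_geometric_sum aq) (simp add: a_def algebra_simps power_add)
  finally show ?thesis
    by (simp only: bit_poly_add_self add_0_right monom_one_eq_power four_power_eq flip: X_def q_def)
qed

lemma ell1_cofactor_r2: "ell1 (cofactor_r2 r) + 3 ^ r = 4 ^ r + 2 ^ r"
proof -
  define q :: nat where "q = 2 ^ r"
  define S where "S = (\<Sum>k<q - 1. [:0, 1:] ^ (q * k) * (1 + [:0, 1:] :: bit poly) ^ k)"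
  have q: "q = Suc (q - 1)" by (simp add: q_def)
  have S: "ones S \<subseteq> {..<q * (q - 1)}" "ell1 S = (\<Sum>k<q - 1. ell1 ((1 + [:0, 1:]) ^ k))"
    using ell1_sum_blocks[of "q - 1" "\<lambda>k. (1 + [:0, 1:]) ^ k" q] ones_one_add_X_power
    by (simp_all add: S_def)
  \<comment> \<open>\<open>S\<close> contains the rows up to \<open>q - 2\<close>, so the
    \<open>2 ^ r\<close> ones of row \<open>q - 1\<close> come off the total
    \<open>3 ^ r\<close>.\<close>
  have "(\<Sum>k<q. ell1 ((1 + [:0, 1:]) ^ k)) = ell1 S + ell1 ((1 + [:0, 1:]) ^ (q - 1))"
    by (subst q) (simp add: S(2))
  then have eS: "ell1 S + 2 ^ r = 3 ^ r"
    by (simp add: q_def sum_ell1_one_add_X_power ell1_one_add_X_power_two_power_minus_one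
        del: One_nat_def)
  have "q + q * (q - 1) = q * q" by (subst (4) q) (simp add: algebra_simps)
  then have "ones ([:0, 1:] ^ q * S) \<subseteq> {..<4 ^ r}"
    using S(1) by (fastforce simp: ones_power_mult four_power_eq simp flip: q_def)
  then have "ell1 (cofactor_r2 r) + ell1 ([:0, 1:] ^ q * S) = 4 ^ r"
    using ell1_geometric_sum_add by (simp add: cofactor_r2_def S_def q_def)
  then show ?thesis using eS by (simp add: ell1_power_mult)
qed

section \<open>Multiples of the order and periodicity\<close>

text \<open>Division with remainder: reducing \<open>N\<close> modulo the order preserves
  divisibility by \<open>f\<close>, so a nonzero remainder would contradict minimality.\<close>

lemma dvd_one_add_monom_imp_poly_ord_dvd:
  assumes f: "coeff f 0 = 1" and N: "f dvd 1 + monom 1 N"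
  shows "poly_ord f dvd N"
proof (rule ccontr)
  let ?D = "poly_ord f" and ?X = "[:0, 1:] :: bit poly"
  assume "\<not> ?D dvd N"
  then have pos: "N mod ?D \<ge> 1" by (simp add: dvd_eq_mod_eq_0 Suc_le_eq)
  have D: "f dvd 1 + ?X ^ ?D" "?D \<ge> 1"
    using poly_ord_props[OF f] by (simp_all add: monom_one_eq_power)
  have "1 + ?X ^ ?D dvd 1 + (?X ^ ?D) ^ (N div ?D)"
    by (metis bit_poly_geometric_sum dvd_triv_left)
  then have "f dvd ?X ^ (N mod ?D) * (1 + ?X ^ (?D * (N div ?D)))"
    using D(1) by (simp add: power_mult dvd_trans)
  also have "?X ^ (N mod ?D) * (1 + ?X ^ (?D * (N div ?D))) = ?X ^ (N mod ?D) + ?X ^ N"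
    by (simp add: distrib_left flip: power_add)
  finally have "f dvd (1 + ?X ^ N) - (?X ^ (N mod ?D) + ?X ^ N)"
    using N by (intro dvd_diff) (simp_all only: monom_one_eq_power)
  moreover have "(1 + ?X ^ N) - (?X ^ (N mod ?D) + ?X ^ N) = 1 + monom 1 (N mod ?D)"
    by (simp add: monom_one_eq_power bit_poly_diff_eq_add[of 1])
  ultimately have "f dvd 1 + monom 1 (N mod ?D)" by metis
  then have "?D \<le> N mod ?D"
    using pos Least_le[of "\<lambda>D. D \<ge> 1 \<and> f dvd 1 + monom 1 D" "N mod ?D"]
    by (simp only: poly_ord_def)
  then show False using D(2) mod_less_divisor[of ?D N] by linarith
qed

lemma degree_add_degree_poly_star:
  assumes "coeff f 0 = 1"
  shows "degree f + degree (poly_star f) = poly_ord f"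
proof -
  have D: "poly_ord f \<ge> 1" using poly_ord_props[OF assms] by simp
  have "degree (1 + monom (1::bit) (poly_ord f)) = poly_ord f"
    using D by (subst degree_add_eq_right) (auto simp: degree_monom_eq)
  moreover from this have "f \<noteq> 0" "poly_star f \<noteq> 0"
    using D poly_star_eq[OF assms] by auto
  ultimately show ?thesis by (metis degree_mult_eq poly_star_eq[OF assms])
qed

text \<open>Cancelling \<open>f\<close> shows that \<open>h\<close> is a sum of shifted copies of
  \<open>poly_star f\<close>, one per period. They are disjoint because
  \<open>degree f \<ge> 1\<close> forces \<open>degree (poly_star f) < poly_ord f\<close>. Hence the
  density of ones can be read off from any such \<open>N\<close>.\<close>

lemma ell1_mult_poly_ord:
  assumes f: "coeff f 0 = 1" "degree f \<ge> 1" and h: "f * h = 1 + monom 1 N"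
  shows "ell1 h * poly_ord f = ell1 (poly_star f) * N"
proof -
  let ?D = "poly_ord f" and ?X = "[:0, 1:] :: bit poly"
  obtain m where m: "N = ?D * m"
    using dvd_one_add_monom_imp_poly_ord_dvd[OF f(1)] h by (metis dvdE dvd_triv_left)
  have "f * h = (1 + ?X ^ ?D) * (\<Sum>k<m. (?X ^ ?D) ^ k)"
    by (simp only: h bit_poly_geometric_sum monom_one_eq_power m power_mult)
  also have "\<dots> = f * (\<Sum>k<m. ?X ^ (?D * k) * poly_star f)"
    using poly_star_eq[OF f(1)]
    by (simp only: monom_one_eq_power power_mult sum_distrib_right[symmetric]) (metis mult.assoc mult.commute)
  finally have "h = (\<Sum>k<m. ?X ^ (?D * k) * poly_star f)"
    using f by auto
  moreover have "ones (poly_star f) \<subseteq> {..<?D}"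
    using degree_add_degree_poly_star[OF f(1)] f(2) by (intro ones_subset_degree) linarith
  ultimately have "ell1 h = m * ell1 (poly_star f)"
    using ell1_sum_blocks[of m "\<lambda>_. poly_star f" ?D] by simp
  then show ?thesis by (simp add: m)
qed

lemma robust_iff:
  assumes f: "coeff f 0 = 1" "degree f \<ge> 1"
  shows "robust f \<longleftrightarrow> 2 * ell1 (poly_star f) > poly_ord f + 1"
proof -
  let ?D = "poly_ord f" and ?g = "poly_star f"
  have D: "?D \<ge> 1" using poly_ord_props[OF f(1)] by simp
  have sub: "ones ?g \<subseteq> {..<?D}"
    using degree_add_degree_poly_star[OF f(1)] f(2) by (intro ones_subset_degree) linarith
  have "{k \<in> {0..?D - 1}. coeff ?g k = 0} = {..<?D} - ones ?g"
    using D by (auto simp: ones_def)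
  then have "ell0 (?D - 1) ?g + ell1 ?g = ?D"
    using sub card_mono[OF _ sub] by (simp add: ell0_def ell1_eq_card_ones card_Diff_subset)
  then show ?thesis unfolding robust_def by linarith
qed

section \<open>Density, robustness and limit for the family\<close>

lemma coeff_f_r2_0: "coeff (f_r2 r) 0 = 1"
  by (simp add: f_r2_def)

lemma degree_f_r2: "degree (f_r2 r) = 2 ^ r + 2"
proof -
  have "degree (1 + monom 1 1 + monom (1::bit) (2 ^ r)) \<le> 2 ^ r"
    by (intro degree_add_le) (auto simp: degree_monom_eq)
  then show ?thesis
    unfolding f_r2_def by (subst degree_add_eq_right) (auto simp: degree_monom_eq)
qed

lemma gamma_f_r2: "gamma (f_r2 r) = (4 ^ r - 3 ^ r + 2 ^ r) / (4 ^ r + 2 ^ r + 1)"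
proof -
  have "ell1 (cofactor_r2 r) * poly_ord (f_r2 r) = ell1 (poly_star (f_r2 r)) * (4 ^ r + 2 ^ r + 1)"
    by (rule ell1_mult_poly_ord) (simp_all add: coeff_f_r2_0 degree_f_r2 f_r2_mult_cofactor_r2)
  then have "real (ell1 (cofactor_r2 r)) * real (poly_ord (f_r2 r)) =
      real (ell1 (poly_star (f_r2 r))) * (4 ^ r + 2 ^ r + 1)"
    by (simp flip: of_nat_mult add: distrib_left)
       (metis (mono_tags) of_nat_add of_nat_mult of_nat_numeral of_nat_power)
  moreover have "real (ell1 (cofactor_r2 r)) + 3 ^ r = 4 ^ r + 2 ^ r"
    using ell1_cofactor_r2[of r] by (metis of_nat_add of_nat_numeral of_nat_power)
  then have "4 ^ r - 3 ^ r + 2 ^ r = real (ell1 (cofactor_r2 r))" by simp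
  moreover have "real (poly_ord (f_r2 r)) > 0"
    using poly_ord_props(1)[OF coeff_f_r2_0, of r] by simp
  moreover have "(4 ^ r + 2 ^ r + 1 :: real) > 0" by (simp add: add_pos_pos)
  ultimately show ?thesis
    unfolding gamma_def by (simp add: frac_eq_eq)
qed

lemma poly_ord_f_r2_ge: "poly_ord (f_r2 r) \<ge> 2 ^ r + 2"
  using degree_add_degree_poly_star[OF coeff_f_r2_0, of r] by (simp add: degree_f_r2)

lemma robust_f_r2:
  assumes "r \<ge> 3"
  shows "robust (f_r2 r)"
proof -
  define D where "D = real (poly_ord (f_r2 r))"
  have "(2::nat) ^ 3 \<le> 2 ^ r" using assms by (intro power_increasing) auto
  then have D: "D \<ge> 10" using poly_ord_f_r2_ge[of r] by (simp add: D_def)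
  \<comment> \<open>This says \<open>gamma (f_r2 r) > 11/20\<close>; the value 11/20 is
    \<open>(D + 1) / (2 * D)\<close> at \<open>D = 10\<close>, its largest value for
    \<open>D \<ge> 10\<close>.\<close>
  have "20 * (3::real) ^ r + 11 < 9 * 4 ^ r + 9 * 2 ^ r"
    using assms
  proof (induction r rule: dec_induct)
    case (step n)
    moreover have "(2::real) ^ n \<le> 4 ^ n" by (rule power_mono) auto
    ultimately show ?case unfolding power_Suc by linarith
  qed simp
  \<comment> \<open>With \<open>A\<close> and \<open>B\<close> the numerator and denominator of
    \<open>gamma\<close>, the bracket is \<open>2 * A - B\<close>, and the goal
    \<open>(D + 1) * B < 2 * D * A\<close> reads \<open>B < D * (2 * A - B)\<close>. The case
    \<open>D = 10\<close> suffices, as it makes the bracket positive.\<close>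
  then have num: "4 ^ r + 2 ^ r + 1 < 10 * (4 ^ r - 2 * 3 ^ r + 2 ^ r - (1::real))" by simp
  also have "\<dots> \<le> D * (4 ^ r - 2 * 3 ^ r + 2 ^ r - 1)"
  proof (rule mult_right_mono[OF D])
    have "(4::real) ^ r + 2 ^ r + 1 > 0" by (simp add: add_pos_pos)
    from less_trans[OF this num] show "0 \<le> 4 ^ r - 2 * 3 ^ r + 2 ^ r - (1::real)"
      by (simp only: zero_less_mult_iff) simp
  qed
  finally have "(D + 1) * (4 ^ r + 2 ^ r + 1) < 2 * D * (4 ^ r - 3 ^ r + 2 ^ r)"
    by (simp add: algebra_simps)
  moreover have "(4 ^ r + 2 ^ r + 1 :: real) > 0" by (simp add: add_pos_pos)
  ultimately have "D + 1 < 2 * D * gamma (f_r2 r)"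
    by (simp add: gamma_f_r2 pos_less_divide_eq)
  also have "\<dots> = 2 * real (ell1 (poly_star (f_r2 r)))"
    using D by (simp add: gamma_def D_def)
  finally show ?thesis
    by (subst robust_iff) (simp_all add: coeff_f_r2_0 degree_f_r2 D_def)
qed

text \<open>Dividing through by \<open>4 ^ r\<close> leaves geometric sequences with ratios 3/4, 1/2
  and 1/4.\<close>

lemma gamma_f_r2_tendsto: "(\<lambda>r. gamma (f_r2 r)) \<longlonglongrightarrow> 1"
proof -
  have "gamma (f_r2 r) = (1 - (3/4) ^ r + (1/2) ^ r) / (1 + (1/2) ^ r + (1/4) ^ r)" for r
  proof -
    have "(4::real) ^ r = 2 ^ r * 2 ^ r" by (simp flip: power_mult_distrib)
    then have "(1/2 :: real) ^ r = 2 ^ r / 4 ^ r" by (simp add: power_divide)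
    then have "1 - (3/4) ^ r + (1/2) ^ r = (4 ^ r - 3 ^ r + 2 ^ r) / (4 ^ r :: real)"
      "1 + (1/2) ^ r + (1/4) ^ r = (4 ^ r + 2 ^ r + 1) / (4 ^ r :: real)"
      by (simp_all add: power_divide diff_divide_distrib add_divide_distrib)
    then show ?thesis by (simp add: gamma_f_r2)
  qed
  moreover have "(\<lambda>r. (1 - (3/4) ^ r + (1/2) ^ r) / (1 + (1/2) ^ r + (1/4) ^ r)) \<longlonglongrightarrow>
      (1 - 0 + 0) / (1 + 0 + (0::real))"
    by (intro tendsto_intros LIMSEQ_realpow_zero) auto
  ultimately show ?thesis by simp
qed

theorem mainTheorem3:
  shows "(\<forall>r\<ge>3. robust (f_r2 r) \<and> poly_ord (f_r2 r) dvd 4 ^ r + 2 ^ r + 1) \<and>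
         (\<lambda>r. gamma (f_r2 r)) \<longlonglongrightarrow> 1"
proof (intro conjI allI impI)
  fix r
  have "f_r2 r dvd 1 + monom 1 (4 ^ r + 2 ^ r + 1)"
    by (metis f_r2_mult_cofactor_r2 dvd_triv_left)
  then show "poly_ord (f_r2 r) dvd 4 ^ r + 2 ^ r + 1"
    by (rule dvd_one_add_monom_imp_poly_ord_dvd[OF coeff_f_r2_0])
qed (simp_all add: robust_f_r2 gamma_f_r2_tendsto)

end
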